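(* Let $m$, $n$ and $k$ be integers (with $m,n\geq 1$) such that $m \leq n$ and $\gamma(K_{m,n}) < k < m+n$. Then $\mathcal{D}_k(K_{m,n})$ is Eulerian if and only if one of the following holds: (i) $m=1$, $n$ is even, and $k$ is odd; or (ii) $m \geq 3$, $m \equiv n \pmod 2$, and $k=3$.
   Context: All graphs are finite and simple. $K_{m,n}$ is the complete bipartite graph with partite sets of sizes $m$ and $n$. A dominating set of a graph $G$ is a set $D \subseteq V(G)$ such that every vertex of $V(G)\setminus D$ is adjacent to a vertex of $D$; the domination number $\gamma(G)$ is the cardinality of a smallest dominating set of $G$. The $k$-dominating graph $\mathcal{D}_k(G)$ is the graph whose vertices are the dominating sets of $G$ of cardinality at most $k$, two of them being adjacent if and only if one can be obtained from the other by adding or removing a single vertex of $G$. A graph is Eulerian if and only if every vertex has even degree and it contains at most one non-trivial component (a graph or component is trivial if it contains no edges); in particular, an Eulerian graph may have isolated vertices. *)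

theory Defs
  imports
    "Graph_Theory.Kuratowski"
    "HOL-Number_Theory.Cong"
begin

text \<open>
  A finite simple graph is a digraph satisfying the locale predicate \<^const>\<open>graph\<close>
  of the Graph\_Theory library: finite, loop-free, symmetric and without parallel arcs,
  each undirected edge being the pair of its two opposite arcs.
\<close>

definition dominating_set :: "('a, 'b) pre_digraph \<Rightarrow> 'a set \<Rightarrow> bool" where
  "dominating_set G D \<longleftrightarrow>
     D \<subseteq> verts G \<and> (\<forall>v \<in> verts G - D. \<exists>u \<in> D. v \<rightarrow>\<^bsub>G\<^esub> u)"

definition domination_number :: "('a, 'b) pre_digraph \<Rightarrow> nat" where
  "domination_number G = Min (card ` {D. dominating_set G D})"

definition dominating_graph :: "nat \<Rightarrow> ('a, 'b) pre_digraph \<Rightarrow> 'a set pair_pre_digraph" where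
  "dominating_graph k G =
     (let \<D> = {D. dominating_set G D \<and> card D \<le> k}
      in \<lparr> pverts = \<D>,
           parcs = {(A, B). A \<in> \<D> \<and> B \<in> \<D> \<and>
             (\<exists>v \<in> verts G. (v \<notin> A \<and> B = A \<union> {v}) \<or> (v \<in> A \<and> B = A - {v}))} \<rparr>)"

text \<open>
  For a graph \<open>H\<close>, the degree of a vertex is its out-degree, because each incident
  undirected edge contributes exactly one outgoing arc. The connected components are the
  strongly connected components, because the arc relation is symmetric.
\<close>

definition eulerian :: "('a, 'b) pre_digraph \<Rightarrow> bool" where
  "eulerian H \<longleftrightarrow>
     (\<forall>v \<in> verts H. even (out_degree H v)) \<and>
     (\<exists>\<^sub>\<le>\<^sub>1 C. C \<in> pre_digraph.sccs H \<and> arcs C \<noteq> {})"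

lemma pair_graph_dominating_graph:
  assumes "finite (verts G)"
  shows "pair_graph (dominating_graph k G)"
proof -
  have fin: "finite (pverts (dominating_graph k G))"
    by (rule finite_subset[of _ "Pow (verts G)"])
       (auto simp: dominating_graph_def Let_def dominating_set_def assms)
  have "parcs (dominating_graph k G)
      \<subseteq> pverts (dominating_graph k G) \<times> pverts (dominating_graph k G)"
    by (auto simp: dominating_graph_def Let_def)
  with fin have "finite (parcs (dominating_graph k G))"
    by (meson finite_SigmaI finite_subset)
  moreover have "sym (parcs (dominating_graph k G))"
    by (rule symI) (auto simp: dominating_graph_def Let_def insert_absorb)
  ultimately show ?thesis
    using fin by unfold_locales (auto simp: dominating_graph_def Let_def symmetric_def)
qed

end

theory Submission
  imports Defs
begin

text \<open>
  In the star case the dominating sets containing the centre have degree \<open>n\<close> if they are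
  smaller than \<open>k\<close> and \<open>k - 1\<close> otherwise, and deleting leaves connects them all to the centre.
  For \<open>m \<ge> 2\<close> the pair \<open>{u, v}\<close> with one vertex on each side has degree \<open>m + n - 2\<close>, while
  \<open>{u, v, v'}\<close> would have degree \<open>m + n - 1\<close> if \<open>k > 3\<close> and \<open>n \<ge> 3\<close>; so \<open>k = 3\<close>. If \<open>m = 2\<close>,
  then \<open>U \<union> {v}\<close> has degree 3. If \<open>m \<ge> 3\<close> and \<open>k = 3\<close>, triples meeting both sides have degree 2,
  all sets meeting both sides are connected through exchanges of a vertex of a pair, and the
  only other possible dominating sets, \<open>U\<close> and \<open>V\<close>, are isolated.
\<close>

section \<open>Components, degrees and paths in a dominating graph\<close>

text \<open>The tail of an arc in a nontrivial component reaches \<open>r\<close>, and symmetry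
  gives the way back, so every such component contains \<open>r\<close>; distinct components are
  disjoint.\<close>

lemma (in sym_digraph) Uniq_nontrivial_sccs:
  assumes "\<And>e. e \<in> arcs G \<Longrightarrow> tail G e \<rightarrow>\<^sup>* r"
  shows "\<exists>\<^sub>\<le>\<^sub>1 C. C \<in> sccs \<and> arcs C \<noteq> {}"
proof -
  have r_in: "\<exists>S \<in> sccs_verts. C = G \<restriction> S \<and> r \<in> S" if "C \<in> sccs" "arcs C \<noteq> {}" for C
  proof -
    obtain S where S: "S \<in> sccs_verts" "C = G \<restriction> S"
      using \<open>C \<in> sccs\<close> by (auto simp: sccs_conv_sccs_verts)
    obtain e where e: "e \<in> arcs G" "tail G e \<in> S"
      using \<open>arcs C \<noteq> {}\<close> S(2) by auto
    have "tail G e \<rightarrow>\<^sup>* r" "r \<rightarrow>\<^sup>* tail G e"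
      using assms e(1) by (auto intro: symmetric_reachable')
    then have "r \<in> S"
      using S(1) e(2) by (auto simp: in_sccs_verts_conv_reachable)
    with S show ?thesis by blast
  qed
  show ?thesis
    unfolding Uniq_def using r_in sccs_verts_disjoint by (metis disjoint_iff)
qed

lemma dominating_set_mono:
  assumes "dominating_set G D" "D \<subseteq> E" "E \<subseteq> verts G"
  shows "dominating_set G E"
  using assms unfolding dominating_set_def by blast

lemma pverts_dominating_graph:
  "pverts (dominating_graph k G) = {D. dominating_set G D \<and> card D \<le> k}"
  by (simp add: dominating_graph_def)

lemma parcs_dominating_graph:
  "(A, B) \<in> parcs (dominating_graph k G) \<longleftrightarrow>
     A \<in> pverts (dominating_graph k G) \<and> B \<in> pverts (dominating_graph k G) \<and>
     (\<exists>v \<in> verts G. (v \<notin> A \<and> B = insert v A) \<or> (v \<in> A \<and> B = A - {v}))"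
  by (simp add: dominating_graph_def)

text \<open>Supersets of a dominating set dominate, so insertions are limited by size alone, while
  deletions are limited by domination alone. \<open>Q\<close> is a parameter so that each
  application can supply the removable vertices in explicit form.\<close>

lemma out_degree_dominating_graph:
  assumes fin: "finite (verts G)" and D: "dominating_set G D" "card D \<le> k"
    and Q: "{v \<in> D. dominating_set G (D - {v})} = Q"
  shows "out_degree (with_proj (dominating_graph k G)) D =
    (if card D < k then card (verts G - D) else 0) + card Q"
proof -
  let ?H = "dominating_graph k G"
  define P where "P = (if card D < k then verts G - D else {})"
  have sub: "D \<subseteq> verts G" using D(1) by (simp add: dominating_set_def)
  have finD: "finite D" using fin sub finite_subset by blast
  have insert_iff: "dominating_set G (insert v D) \<and> card (insert v D) \<le> k \<longleftrightarrow> v \<in> P"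
    if "v \<in> verts G" "v \<notin> D" for v
    using that finD sub dominating_set_mono[OF D(1), of "insert v D"]
    by (auto simp: P_def)
  have remove_iff: "dominating_set G (D - {v}) \<and> card (D - {v}) \<le> k \<longleftrightarrow> v \<in> Q"
    if "v \<in> D" for v
    using that finD D(2) by (auto simp flip: Q)
  have "{e \<in> parcs ?H. fst e = D} =
      (\<lambda>v. (D, insert v D)) ` P \<union> (\<lambda>v. (D, D - {v})) ` Q" (is "_ = ?P \<union> ?Q")
  proof (intro set_eqI)
    fix e
    show "e \<in> {e \<in> parcs ?H. fst e = D} \<longleftrightarrow> e \<in> ?P \<union> ?Q"
    proof (cases e)
      case (Pair A B)
      have "(D, B) \<in> parcs ?H \<longleftrightarrow> (\<exists>v \<in> verts G. v \<notin> D \<and> B = insert v D \<and> v \<in> P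
           \<or> v \<in> D \<and> B = D - {v} \<and> v \<in> Q)"
        using D insert_iff remove_iff
        by (auto simp: parcs_dominating_graph pverts_dominating_graph simp del: card_insert_disjoint)
      moreover have "P \<subseteq> verts G - D" "Q \<subseteq> D" by (auto simp: P_def simp flip: Q)
      ultimately show ?thesis using Pair sub by auto
    qed
  qed
  moreover have "finite P" "finite Q" using fin finD by (auto simp: P_def simp flip: Q)
  moreover have "?P \<inter> ?Q = {}" by (auto simp: P_def simp flip: Q)
  moreover have "inj_on (\<lambda>v. (D, insert v D)) P"
    by (rule inj_onI) (auto simp: P_def split: if_splits)
  moreover have "inj_on (\<lambda>v. (D, D - {v})) Q"
    by (rule inj_onI) (auto simp flip: Q)
  ultimately have "card {e \<in> parcs ?H. fst e = D} = card P + card Q"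
    by (simp add: card_Un_disjoint card_image)
  then show ?thesis by (simp add: out_degree_def out_arcs_def P_def)
qed

text \<open>The case of \<open>v\<close> in \<open>A\<close>, where the path is trivial, is included
  so that exchange arguments can ignore coincidences between vertices.\<close>

lemma reachable_dominating_graph_insert:
  assumes "finite (verts G)" "dominating_set G A" "v \<in> verts G" "card (insert v A) \<le> k"
  shows "A \<rightarrow>\<^sup>*\<^bsub>with_proj (dominating_graph k G)\<^esub> insert v A"
    "insert v A \<rightarrow>\<^sup>*\<^bsub>with_proj (dominating_graph k G)\<^esub> A"
proof -
  interpret pair_graph "dominating_graph k G"
    by (rule pair_graph_dominating_graph) fact
  have "A \<subseteq> verts G" using assms(2) by (simp add: dominating_set_def)
  then have "dominating_set G (insert v A)"
    using assms by (auto intro: dominating_set_mono)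
  moreover have "card A \<le> card (insert v A)"
    using \<open>A \<subseteq> verts G\<close> assms(1) by (intro card_mono) (auto intro: finite_subset)
  ultimately have "A \<in> pverts (dominating_graph k G)" "insert v A \<in> pverts (dominating_graph k G)"
    using assms by (auto simp: pverts_dominating_graph)
  then show "A \<rightarrow>\<^sup>*\<^bsub>with_proj (dominating_graph k G)\<^esub> insert v A"
    using assms(3)
    by (cases "v \<in> A") (auto simp: insert_absorb parcs_dominating_graph intro!: reachable_adjI)
  then show "insert v A \<rightarrow>\<^sup>*\<^bsub>with_proj (dominating_graph k G)\<^esub> A"
    by (rule symmetric_reachable')
qed

text \<open>Reachability of \<open>R\<close> is asked only of sets that have an incident arc, so
  isolated dominating sets such as a whole side are allowed.\<close>

lemma eulerian_dominating_graphI: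
  assumes "finite (verts G)"
    and "\<And>D. dominating_set G D \<Longrightarrow> card D \<le> k \<Longrightarrow>
      even (out_degree (with_proj (dominating_graph k G)) D)"
    and "\<And>D E. (D, E) \<in> parcs (dominating_graph k G) \<Longrightarrow>
      D \<rightarrow>\<^sup>*\<^bsub>with_proj (dominating_graph k G)\<^esub> R"
  shows "eulerian (with_proj (dominating_graph k G))"
proof -
  interpret pair_graph "dominating_graph k G"
    by (rule pair_graph_dominating_graph) fact
  have "\<exists>\<^sub>\<le>\<^sub>1 C. C \<in> sccs \<and> arcs C \<noteq> {}"
    using assms(3) by (intro Uniq_nontrivial_sccs) auto
  then show ?thesis
    using assms(2) by (auto simp: eulerian_def pverts_dominating_graph)
qed

section \<open>Dominating sets of a complete bipartite graph\<close>

locale complete_bipartition =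
  fixes G :: "('a, 'b) pre_digraph" and U V :: "'a set"
  assumes verts_eq: "verts G = U \<union> V"
    and disjoint: "U \<inter> V = {}"
    and arcs_ends_eq: "arcs_ends G = U \<times> V \<union> V \<times> U"
    and finite_U: "finite U" and finite_V: "finite V"
    and U_nonempty: "U \<noteq> {}" and V_nonempty: "V \<noteq> {}"
begin

lemma finite_verts_G: "finite (verts G)"
  by (simp add: verts_eq finite_U finite_V)

text \<open>A vertex of \<open>U\<close> outside \<open>D\<close> can be dominated only from
  \<open>V\<close>, and any vertex of \<open>V\<close> does so; likewise with the sides swapped.
  Hence a dominating set meets both sides or is \<open>U\<close> or \<open>V\<close> itself.\<close>

lemma dominating_set_iff:
  "dominating_set G D \<longleftrightarrow>
     D \<subseteq> U \<union> V \<and> (U \<subseteq> D \<or> D \<inter> V \<noteq> {}) \<and> (V \<subseteq> D \<or> D \<inter> U \<noteq> {})"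
  using disjoint U_nonempty V_nonempty
  unfolding dominating_set_def verts_eq arcs_ends_eq by blast

lemma finite_dominating_set: "dominating_set G D \<Longrightarrow> finite D"
  using finite_U finite_V by (auto simp: dominating_set_iff intro: finite_subset)

lemma domination_number_attained: "\<exists>D. dominating_set G D \<and> card D = domination_number G"
proof -
  have "{D. dominating_set G D} \<subseteq> Pow (U \<union> V)" by (auto simp: dominating_set_iff)
  then have "finite {D. dominating_set G D}"
    using finite_U finite_V finite_subset by blast
  moreover have "dominating_set G (U \<union> V)" by (auto simp: dominating_set_iff)
  ultimately have "domination_number G \<in> card ` {D. dominating_set G D}"
    unfolding domination_number_def by (intro Min_in) auto
  then show ?thesis by auto
qed

lemma domination_number_pos: "domination_number G \<ge> 1"
proof -
  obtain D where "dominating_set G D" "card D = domination_number G"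
    using domination_number_attained by blast
  moreover from this have "D \<noteq> {}"
    using U_nonempty by (auto simp: dominating_set_iff)
  ultimately show ?thesis
    using finite_dominating_set by (metis One_nat_def Suc_leI card_gt_0_iff)
qed

text \<open>A dominating set contains a whole side or a vertex of each side, hence two vertices in
  any case. This makes \<open>k\<close> at least 3 when neither side is a single vertex.\<close>

lemma domination_number_ge_2:
  assumes "card U \<ge> 2" "card V \<ge> 2"
  shows "domination_number G \<ge> 2"
proof -
  obtain D where D: "dominating_set G D" "card D = domination_number G"
    using domination_number_attained by blast
  note fin = finite_dominating_set[OF D(1)]
  consider "U \<subseteq> D" | "V \<subseteq> D" | u v where "u \<in> U" "v \<in> V" "{u, v} \<subseteq> D"
    using D(1) by (auto simp: dominating_set_iff)
  then show ?thesis
  proof cases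
    case 1
    then show ?thesis using card_mono[OF fin 1] assms D(2) by linarith
  next
    case 2
    then show ?thesis using card_mono[OF fin 2] assms D(2) by linarith
  next
    case 3
    then have "u \<noteq> v" using disjoint by blast
    then show ?thesis using card_mono[OF fin, of "{u, v}"] 3 D(2) by simp
  qed
qed

lemma eulerian_imp_even_degree:
  assumes "eulerian (with_proj (dominating_graph k G))"
    and "dominating_set G D" "card D \<le> k"
    and "{v \<in> D. dominating_set G (D - {v})} = R"
  shows "even ((if card D < k then card (verts G - D) else 0) + card R)"
proof -
  have "even (out_degree (with_proj (dominating_graph k G)) D)"
    using assms(1-3) by (simp add: eulerian_def pverts_dominating_graph)
  then show ?thesis
    by (simp add: out_degree_dominating_graph[OF finite_verts_G assms(2-)])
qed

section \<open>Stars\<close>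

text \<open>Every leaf in \<open>D\<close> can be removed, since the centre alone dominates; the
  centre cannot, since some leaf is missing. Below size \<open>k\<close> the insertions and
  deletions add up to the number of all leaves; at size \<open>k\<close> only the
  \<open>k - 1\<close> deletions remain.\<close>

lemma star_degree:
  assumes U: "U = {c}" and D: "dominating_set G D" "c \<in> D" "card D \<le> k" and k: "k \<le> card V"
  shows "out_degree (with_proj (dominating_graph k G)) D = (if card D < k then card V else k - 1)"
proof -
  have fin: "finite D" using D(1) by (rule finite_dominating_set)
  have sub: "D \<subseteq> insert c V" using D(1) U by (auto simp: dominating_set_iff)
  have cV: "c \<notin> V" using U disjoint by auto
  \<comment> \<open>All leaves together with the centre would be \<open>card V + 1\<close> vertices,
    more than the \<open>k\<close> allowed.\<close>
  have "\<not> V \<subseteq> D"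
  proof
    assume "V \<subseteq> D"
    then have "card (insert c V) \<le> card D"
      using D(2) fin by (intro card_mono) auto
    then show False using cV finite_V D(3) k by simp
  qed
  then have "{v \<in> D. dominating_set G (D - {v})} = D - {c}"
    using D(2) sub U by (auto simp: dominating_set_iff)
  moreover have "card (verts G - D) = card V - (card D - 1)"
  proof -
    have "verts G - D = V - (D - {c})" using U D(2) cV by (auto simp: verts_eq)
    then show ?thesis
      using sub fin D(2) by (simp add: card_Diff_subset subset_insert_iff)
  qed
  moreover have "card D - 1 \<le> card V" "card D \<ge> 1"
    using D k fin by (auto simp: Suc_le_eq card_gt_0_iff)
  ultimately show ?thesis
    using D out_degree_dominating_graph[OF finite_verts_G D(1,3)] fin by simp
qed

lemma star_reachable:
  assumes U: "U = {c}" and D: "dominating_set G D" "c \<in> D" "card D \<le> k"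
  shows "D \<rightarrow>\<^sup>*\<^bsub>with_proj (dominating_graph k G)\<^esub> {c}"
proof -
  interpret pair_graph "dominating_graph k G"
    by (rule pair_graph_dominating_graph) (rule finite_verts_G)
  have "insert c A \<rightarrow>\<^sup>*\<^bsub>with_proj (dominating_graph k G)\<^esub> {c}"
    if "finite A" "A \<subseteq> V" "card (insert c A) \<le> k" for A
    using that
  proof (induction A)
    case empty
    then show ?case using U by (auto simp: pverts_dominating_graph dominating_set_iff)
  next
    case (insert v A)
    have "v \<noteq> c" using insert U disjoint by auto
    have "card (insert c A) \<le> card (insert c (insert v A))"
      using insert by (intro card_mono) auto
    with insert have "insert c A \<rightarrow>\<^sup>*\<^bsub>with_proj (dominating_graph k G)\<^esub> {c}" by simp
    moreover have "insert v (insert c A) \<rightarrow>\<^sup>*\<^bsub>with_proj (dominating_graph k G)\<^esub> insert c A"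
      using insert U by (intro reachable_dominating_graph_insert finite_verts_G)
        (auto simp: dominating_set_iff verts_eq insert_commute)
    ultimately show ?case
      by (subst insert_commute) (rule reachable_trans)
  qed
  from this[of "D - {c}"] show ?thesis
    using D U finite_dominating_set[OF D(1)] by (auto simp: dominating_set_iff insert_absorb)
qed

text \<open>Sets with the centre have degree \<open>card V\<close> or \<open>k - 1\<close>, and both
  values occur: at \<open>{c}\<close> and at the centre with \<open>k - 1\<close> leaves. The only
  dominating set without the centre is \<open>V\<close>, which is isolated because
  \<open>insert c V\<close> has more than \<open>k\<close> elements.\<close>

lemma star_eulerian_iff:
  assumes c1: "card U = 1" and k: "2 \<le> k" "k \<le> card V"
  shows "eulerian (with_proj (dominating_graph k G)) \<longleftrightarrow> even (card V) \<and> odd k"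
proof
  obtain c where U: "U = {c}" using c1 by (auto simp: card_1_singleton_iff)
  have cV: "c \<notin> V" using U disjoint by auto
  {
    assume eul: "eulerian (with_proj (dominating_graph k G))"
    have deg: "even (if card D < k then card V else k - 1)"
      if "dominating_set G D" "c \<in> D" "card D \<le> k" for D
      using eul star_degree[OF U that k(2)] that
      by (auto simp: eulerian_def pverts_dominating_graph)
    have "dominating_set G {c}" using U by (auto simp: dominating_set_iff)
    from deg[OF this] have "even (card V)" using k by simp
    moreover obtain A where A: "A \<subseteq> V" "card A = k - 1"
      by (metis k(2) diff_le_self le_trans obtain_subset_with_card_n)
    have fA: "finite A" using A finite_V finite_subset by blast
    have "c \<notin> A" using A cV by auto
    then have "card (insert c A) = k" using A fA k by simp
    moreover have "dominating_set G (insert c A)" using U A by (auto simp: dominating_set_iff)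
    ultimately have "even (k - 1)" using deg[of "insert c A"] by simp
    then have "odd k" using k by simp
    with \<open>even (card V)\<close> show "even (card V) \<and> odd k" by simp
  }
  assume par: "even (card V) \<and> odd k"
  have isolated: "D = V" if "dominating_set G D" "c \<notin> D" for D
    using that U by (auto simp: dominating_set_iff)
  have remove_V: "\<not> dominating_set G (V - {v})" if "v \<in> V" for v
    using that U cV by (auto simp: dominating_set_iff)
  show "eulerian (with_proj (dominating_graph k G))"
  proof (rule eulerian_dominating_graphI[OF finite_verts_G])
    fix D assume D: "dominating_set G D" "card D \<le> k"
    show "even (out_degree (with_proj (dominating_graph k G)) D)"
    proof (cases "c \<in> D")
      case True
      then show ?thesis using star_degree[OF U D(1) True D(2) k(2)] par by auto
    next
      case False
      then have "D = V" using isolated D by blast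
      moreover have "{v \<in> V. dominating_set G (V - {v})} = {}" using remove_V by blast
      \<comment> \<open>Since \<open>k \<le> card V\<close>, the set \<open>V\<close> has size
        exactly \<open>k\<close> here and admits no insertion.\<close>
      ultimately show ?thesis
        using out_degree_dominating_graph[OF finite_verts_G D, of "{}"] D k by simp
    qed
  next
    fix D E assume arc: "(D, E) \<in> parcs (dominating_graph k G)"
    then have D: "dominating_set G D" "card D \<le> k" and E: "dominating_set G E" "card E \<le> k"
      by (auto simp: parcs_dominating_graph pverts_dominating_graph)
    have "c \<in> D"
    proof (rule ccontr)
      assume "c \<notin> D"
      then have "D = V" using isolated D by blast
      then have "E = insert c V"
        using arc remove_V E U by (auto simp: parcs_dominating_graph verts_eq)
      then show False using E k cV finite_V by simp
    qed
    then show "D \<rightarrow>\<^sup>*\<^bsub>with_proj (dominating_graph k G)\<^esub> {c}"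
      using star_reachable[OF U D(1) _ D(2)] by blast
  qed
qed

section \<open>Parity obstructions when both sides have at least two vertices\<close>

text \<open>A pair with one vertex from each side lies below size \<open>k\<close>. Neither vertex
  can be removed, since the other one is not its whole side; the degree is thus
  \<open>card U + card V - 2\<close>.\<close>

lemma eulerian_imp_parity:
  assumes c: "card U \<ge> 2" "card V \<ge> 2" and k: "k \<ge> 3"
    and eul: "eulerian (with_proj (dominating_graph k G))"
  shows "even (card U + card V)"
proof -
  obtain u v where uv: "u \<in> U" "v \<in> V" using U_nonempty V_nonempty by blast
  have ne: "u \<noteq> v" using uv disjoint by auto
  have "\<not> U \<subseteq> {u}" "\<not> V \<subseteq> {v}" using c by (auto dest!: subset_singletonD)
  then have removable: "{w \<in> {u, v}. dominating_set G ({u, v} - {w})} = {}"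
    using uv disjoint ne by (auto simp: dominating_set_iff)
  have "dominating_set G {u, v}" using uv by (auto simp: dominating_set_iff)
  moreover have "card (verts G - {u, v}) = card U + card V - 2"
    using uv ne disjoint finite_U finite_V
    by (subst card_Diff_subset) (auto simp: verts_eq card_Un_disjoint)
  ultimately have "even (card U + card V - 2)"
    using eulerian_imp_even_degree[OF eul _ _ removable] ne k by simp
  then show ?thesis using c by auto
qed

text \<open>If \<open>k\<close> exceeded 3, a triple with one vertex in \<open>U\<close> and two in
  \<open>V\<close> would have \<open>card U + card V - 3\<close> insertions and two deletions, an
  odd total by \<open>eulerian_imp_parity\<close>.\<close>

lemma eulerian_imp_k_eq_3:
  assumes c: "card U \<ge> 2" "card V \<ge> 3" and k: "k \<ge> 3"
    and eul: "eulerian (with_proj (dominating_graph k G))"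
  shows "k = 3"
proof (rule ccontr)
  assume "k \<noteq> 3"
  obtain u where u: "u \<in> U" using U_nonempty by blast
  obtain W where "W \<subseteq> V" "card W = 2"
    using obtain_subset_with_card_n[of 2 V] c(2) by auto
  then obtain v v' where v: "v \<in> V" "v' \<in> V" "v \<noteq> v'" by (auto simp: card_2_iff)
  have ne: "u \<noteq> v" "u \<noteq> v'" using u v disjoint by auto
  let ?D = "{u, v, v'}"
  have card_D: "card ?D = 3" using ne v by simp
  have "\<not> U \<subseteq> {u}" using c by (auto dest!: subset_singletonD)
  \<comment> \<open>Because of a third vertex in \<open>V\<close>, the pair left after removing
    \<open>u\<close> fails to dominate.\<close>
  have "\<not> V \<subseteq> {v, v'}" using c(2) card_mono[of "{v, v'}" V] v by fastforce
  then have removable: "{w \<in> ?D. dominating_set G (?D - {w})} = {v, v'}"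
    using u v disjoint ne by (auto simp: dominating_set_iff)
  have "dominating_set G ?D" using u v by (auto simp: dominating_set_iff)
  moreover have "card (verts G - ?D) = card U + card V - 3"
    using u v ne disjoint finite_U finite_V card_D
    by (subst card_Diff_subset) (auto simp: verts_eq card_Un_disjoint)
  ultimately have "even (card U + card V - 3 + 2)"
    using eulerian_imp_even_degree[OF eul _ _ removable] card_D v(3) k \<open>k \<noteq> 3\<close> by simp
  moreover have "even (card U + card V)" using eulerian_imp_parity c k eul by simp
  ultimately show False using c by simp
qed

text \<open>Adding a vertex of \<open>V\<close> to \<open>U\<close> gives a triple from which each
  vertex may be removed: what remains is \<open>U\<close> or a pair across the sides. At size 3 no
  insertion is left, so the degree is 3.\<close>

lemma not_eulerian_card_2:
  assumes c: "card U = 2" "card V \<ge> 2"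
  shows "\<not> eulerian (with_proj (dominating_graph 3 G))"
proof -
  obtain a b where U: "U = {a, b}" "a \<noteq> b" using c by (auto simp: card_2_iff)
  obtain v where v: "v \<in> V" using V_nonempty by blast
  have ne: "v \<noteq> a" "v \<noteq> b" using U v disjoint by auto
  let ?D = "{a, b, v}"
  have removable: "{w \<in> ?D. dominating_set G (?D - {w})} = ?D"
    using U v ne disjoint by (auto simp: dominating_set_iff)
  have "card ?D = 3" using U ne by simp
  moreover have "dominating_set G ?D" using U v by (auto simp: dominating_set_iff)
  ultimately show ?thesis
    using eulerian_imp_even_degree[of 3 ?D ?D] removable by auto
qed

section \<open>Sufficiency for \<open>k = 3\<close> when both sides have at least three
  vertices\<close>

lemma eulerian_3:
  assumes c: "card U \<ge> 3" "card V \<ge> 3" and par: "even (card U + card V)"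
  shows "eulerian (with_proj (dominating_graph 3 G))"
proof -
  let ?H = "with_proj (dominating_graph 3 G)"
  interpret pair_graph "dominating_graph 3 G"
    by (rule pair_graph_dominating_graph) (rule finite_verts_G)
  obtain u0 v0 where uv0: "u0 \<in> U" "v0 \<in> V" using U_nonempty V_nonempty by blast
  \<comment> \<open>Sides have at least three elements, so a set of at most three cannot contain one
    properly.\<close>
  have no_sub: "W = D" if "W \<subseteq> D" "card D \<le> 3" "finite D" "W = U \<or> W = V" for W D
    using that c by (intro card_seteq) auto
  have pair_reachable: "{u, v} \<rightarrow>\<^sup>*\<^bsub>?H\<^esub> {u0, v0}" if uv: "u \<in> U" "v \<in> V" for u v
  proof -
    \<comment> \<open>An upper bound suffices, so \<open>x\<close>, \<open>y\<close> and
      \<open>z\<close> may coincide.\<close>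
    have card3: "card {x, y, z} \<le> 3" for x y z :: 'a
      using card_length[of "[x, y, z]"] by simp
    have step: "{x, y} \<rightarrow>\<^sup>*\<^bsub>?H\<^esub> {z, x, y}" "{z, x, y} \<rightarrow>\<^sup>*\<^bsub>?H\<^esub> {x, y}"
      if "x \<in> U" "y \<in> V" "z \<in> U \<union> V" for x y z
      using that card3 by (intro reachable_dominating_graph_insert finite_verts_G;
        auto simp: dominating_set_iff verts_eq)+
    \<comment> \<open>First \<open>v\<close> is exchanged for \<open>v0\<close>, then
      \<open>u\<close> for \<open>u0\<close>; each rewriting of a triple puts the vertex to be
      dropped in front.\<close>
    have "{u, v} \<rightarrow>\<^sup>*\<^bsub>?H\<^esub> {v0, u, v}" using step uv uv0 by auto
    also have "{v0, u, v} = {v, u, v0}" by auto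
    also have "{v, u, v0} \<rightarrow>\<^sup>*\<^bsub>?H\<^esub> {u, v0}" using step uv uv0 by auto
    also have "{u, v0} \<rightarrow>\<^sup>*\<^bsub>?H\<^esub> {u0, u, v0}" using step uv uv0 by auto
    also have "{u0, u, v0} = {u, u0, v0}" by auto
    also have "{u, u0, v0} \<rightarrow>\<^sup>*\<^bsub>?H\<^esub> {u0, v0}" using step uv uv0 by auto
    finally show ?thesis .
  qed
  have side: "D = U \<or> D = V" if "dominating_set G D" "card D \<le> 3" "D \<inter> U = {} \<or> D \<inter> V = {}" for D
    using that no_sub finite_dominating_set by (metis dominating_set_iff)
  have remove_side: "\<not> dominating_set G (D - {v})" if "v \<in> D" "D = U \<or> D = V" for D v
    using that disjoint U_nonempty V_nonempty by (auto simp: dominating_set_iff)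
  \<comment> \<open>Letting \<open>w\<close> repeat \<open>u\<close> or \<open>v\<close> treats
    pairs and triples in one form.\<close>
  have mixed: "\<exists>u v w. D = {w, u, v} \<and> u \<in> U \<and> v \<in> V \<and> w \<in> U \<union> V \<and> u \<noteq> v"
    if D: "dominating_set G D" "card D \<le> 3" "D \<inter> U \<noteq> {}" "D \<inter> V \<noteq> {}" for D
  proof -
    obtain u v where uv: "u \<in> D" "u \<in> U" "v \<in> D" "v \<in> V" using D by blast
    then have ne: "u \<noteq> v" using disjoint by auto
    have fin: "finite D" using D finite_dominating_set by blast
    have "card (D - {u, v}) \<le> 1" using D(2) uv ne fin by (simp add: card_Diff_subset)
    then consider "D - {u, v} = {}" | w where "D - {u, v} = {w}"
      using fin by (metis card_1_singleton_iff card_0_eq finite_Diff le_less less_one One_nat_def)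
    then show ?thesis
    proof cases
      case 1
      then have "D = {u, u, v}" using uv by auto
      then show ?thesis using uv ne by blast
    next
      case 2
      then have "D = {w, u, v}" using uv by auto
      moreover have "w \<in> U \<union> V" using 2 D(1) by (auto simp: dominating_set_iff)
      ultimately show ?thesis using uv ne by blast
    qed
  qed
  show ?thesis
  proof (rule eulerian_dominating_graphI[OF finite_verts_G])
    fix D assume D: "dominating_set G D" "card D \<le> 3"
    note deg = out_degree_dominating_graph[OF finite_verts_G D]
    show "even (out_degree ?H D)"
    proof (cases "D \<inter> U = {} \<or> D \<inter> V = {}")
      case True
      then have UV: "D = U \<or> D = V" using side D by blast
      then have removable: "{v \<in> D. dominating_set G (D - {v})} = {}"
        using remove_side by blast
      have "\<not> card D < 3" using UV c by auto
      then show ?thesis using deg[OF removable] by simp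
    next
      case False
      then obtain u v w where e: "D = {w, u, v}" "u \<in> U" "v \<in> V" "w \<in> U \<union> V" "u \<noteq> v"
        using mixed[OF D] by blast
      \<comment> \<open>After losing \<open>x\<close> the set is too small to contain a side, so
        only the condition of meeting both sides remains.\<close>
      have "dominating_set G (D - {x}) \<longleftrightarrow> (D - {x}) \<inter> V \<noteq> {} \<and> (D - {x}) \<inter> U \<noteq> {}"
        if "x \<in> D" for x
      proof -
        have "\<not> W \<subseteq> D - {x}" if "W = U \<or> W = V" for W
          using no_sub[of W D] that \<open>x \<in> D\<close> D(2) finite_dominating_set[OF D(1)] by blast
        then have "\<not> U \<subseteq> D - {x}" "\<not> V \<subseteq> D - {x}" by blast+
        moreover have "D - {x} \<subseteq> U \<union> V" using D(1) by (auto simp: dominating_set_iff)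
        ultimately show ?thesis by (simp only: dominating_set_iff) simp
      qed
      then have removable: "{x \<in> D. dominating_set G (D - {x})}
          = {x \<in> D. (D - {x}) \<inter> V \<noteq> {} \<and> (D - {x}) \<inter> U \<noteq> {}}"
        by (intro Collect_cong conj_cong refl)
      show ?thesis
      proof (cases "w = u \<or> w = v")
        case True
        then have D_eq: "D = {u, v}" using e by auto
        have no_removable: "{x \<in> D. dominating_set G (D - {x})} = {}"
          unfolding removable using e D_eq disjoint by auto
        have "card (verts G - D) = card U + card V - 2"
          using D_eq e disjoint finite_U finite_V
          by (subst card_Diff_subset) (auto simp: verts_eq card_Un_disjoint)
        then show ?thesis using deg[OF no_removable] par D_eq e c by simp
      next
        case w: False
        then have card_D: "card D = 3" using e by simp
        \<comment> \<open>Two of the three vertices share the side of \<open>w\<close>; either may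
          go, but the third is alone on its side.\<close>
        have "{x \<in> D. dominating_set G (D - {x})} = (if w \<in> U then {w, u} else {w, v})"
          unfolding removable using e w disjoint by auto
        from deg[OF this] show ?thesis using card_D w by simp
      qed
    qed
  next
    fix D E assume arc: "(D, E) \<in> parcs (dominating_graph 3 G)"
    then have D: "dominating_set G D" "card D \<le> 3" and E: "dominating_set G E" "card E \<le> 3"
      by (auto simp: parcs_dominating_graph pverts_dominating_graph)
    have "D \<inter> U \<noteq> {} \<and> D \<inter> V \<noteq> {}"
    proof (rule ccontr)
      assume "\<not> (D \<inter> U \<noteq> {} \<and> D \<inter> V \<noteq> {})"
      then have "D = U \<or> D = V" using side D by blast
      \<comment> \<open>A side admits no deletion, so an arc must insert a vertex, which gives a set
        of at least four elements.\<close>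
      then obtain x where "x \<notin> D" "E = insert x D"
        using arc remove_side E by (auto simp: parcs_dominating_graph)
      then show False
        using E c \<open>D = U \<or> D = V\<close> finite_dominating_set[OF D(1)] by auto
    qed
    then obtain u v w where e: "D = {w, u, v}" "u \<in> U" "v \<in> V" "w \<in> U \<union> V"
      using mixed[OF D] by blast
    then have "D \<rightarrow>\<^sup>*\<^bsub>?H\<^esub> {u, v}"
      using D by (auto intro!: reachable_dominating_graph_insert finite_verts_G
        simp: dominating_set_iff verts_eq)
    also have "{u, v} \<rightarrow>\<^sup>*\<^bsub>?H\<^esub> {u0, v0}" using pair_reachable e by blast
    finally show "D \<rightarrow>\<^sup>*\<^bsub>?H\<^esub> {u0, v0}" .
  qed
qed

end

theorem theorem9:
  fixes G :: "('a, 'b) pre_digraph" and m n k :: nat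
  assumes "K\<^bsub>m,n\<^esub> G"
    and "m \<ge> 1" and "n \<ge> 1" and "m \<le> n"
    and "domination_number G < k" and "k < m + n"
  shows "eulerian (with_proj (dominating_graph k G)) \<longleftrightarrow>
    (m = 1 \<and> even n \<and> odd k) \<or> (m \<ge> 3 \<and> [m = n] (mod 2) \<and> k = 3)"
proof -
  obtain U V where UV: "verts G = U \<union> V" "U \<inter> V = {}" "card U = m" "card V = n"
    "arcs_ends G = U \<times> V \<union> V \<times> U"
    using assms(1) by (auto simp: complete_bipartite_digraph_def)
  have "finite U" "finite V" "U \<noteq> {}" "V \<noteq> {}"
    using UV assms(2,3) by (auto intro: card_ge_0_finite)
  then interpret complete_bipartition G U V
    using UV by unfold_locales auto
  have cong: "[m = n] (mod 2) \<longleftrightarrow> even (m + n)"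
    by (simp add: cong_def mod2_eq_if)
  show ?thesis
  proof (cases "m = 1")
    case True
    \<comment> \<open>Here \<open>k < 1 + n\<close> gives \<open>k \<le> n\<close>, and a positive
      domination number gives \<open>k \<ge> 2\<close>.\<close>
    then show ?thesis
      using star_eulerian_iff[of k] domination_number_pos UV assms by auto
  next
    case False
    then have m: "m \<ge> 2" "n \<ge> 2" using assms by auto
    then have k: "k \<ge> 3" using domination_number_ge_2 UV assms by auto
    have "m \<ge> 3 \<and> even (m + n) \<and> k = 3"
      if eul: "eulerian (with_proj (dominating_graph k G))"
    proof -
      \<comment> \<open>If \<open>n = 2\<close> then \<open>m = 2\<close>, and \<open>k < 4\<close>
        leaves only \<open>k = 3\<close>; otherwise \<open>n \<ge> 3\<close> and the triple argument
        applies.\<close>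
      have "k = 3"
        using eulerian_imp_k_eq_3[of k] eul k m UV assms(4,6) by (cases "n = 2") auto
      moreover from this have "m \<noteq> 2" using not_eulerian_card_2 eul UV m by auto
      ultimately show ?thesis using eulerian_imp_parity[of k] eul k m UV by auto
    qed
    moreover have "eulerian (with_proj (dominating_graph k G))"
      if "m \<ge> 3" "even (m + n)" "k = 3"
      using eulerian_3 that UV assms(4) by auto
    ultimately show ?thesis using False cong by blast
  qed
qed

end
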